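(* For a deformed $\mathbb D$-semi-classical orthogonal polynomial system, the spectral matrix $A_n(x;u)$ and the deformation matrix $B_n(x;u)$ satisfy the $\mathbb D$-Schlesinger equation $$\mathbb D_uA_n-\mathbb D_xB_n+\mathbb M_uA_n\,\mathbb M_xB_n-\mathbb M_xB_n\,\mathbb M_uA_n$$ $$=\tfrac14\Delta v^2\,\mathbb M_xB_n\,\mathbb D_uA_n\left(1-\tfrac1{16}\Delta y^2\Delta v^2\,\mathbb D_xB_n\,\mathbb D_uA_n\right)^{-1}\left(\mathbb M_xB_n+\tfrac14\Delta y^2\,\mathbb D_xB_n\,\mathbb M_uA_n\right)$$ $$-\tfrac14\Delta y^2\,\mathbb M_uA_n\,\mathbb D_xB_n\left(1-\tfrac1{16}\Delta y^2\Delta v^2\,\mathbb D_uA_n\,\mathbb D_xB_n\right)^{-1}\left(\mathbb M_uA_n+\tfrac14\Delta v^2\,\mathbb D_uA_n\,\mathbb M_xB_n\right),$$ or the equivalent form $$\left(1-\tfrac12\Delta yA_n(x;v_+)\right)^{-1}\left(1+\tfrac12\Delta yA_n(x;v_+)\right)\left(1-\tfrac12\Delta vB_n(y_-;u)\right)^{-1}\left(1+\tfrac12\Delta vB_n(y_-;u)\right)$$ $$=\left(1-\tfrac12\Delta vB_n(y_+;u)\right)^{-1}\left(1+\tfrac12\Delta vB_n(y_+;u)\right)\left(1-\tfrac12\Delta yA_n(x;v_-)\right)^{-1}\left(1+\tfrac12\Delta yA_n(x;v_-)\right).$$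
   Context: **Lattices.** Let $\iota_\pm(x)$ be the two roots $y$ of a symmetric quadratic $\mathcal Ay^2+2\mathcal Bxy+\mathcal Ax^2+2\mathcal D(x+y)+\mathcal F=0$, $\mathcal A\ne0$; $y_\pm=\iota_\pm(x)$, $\Delta y=y_+-y_-$, $\mathbb D_xh=(h(y_+)-h(y_-))/\Delta y$, $\mathbb M_xh=\frac12(h(y_+)+h(y_-))$. The deformation variable $u$ has its own lattice of this kind (possibly a different conic), with $v_\pm=\iota_\pm(u)$, $\Delta v=v_+-v_-$ and operators $\mathbb D_uh=(h(v_+)-h(v_-))/\Delta v$, $\mathbb M_uh=\frac12(h(v_+)+h(v_-))$. The $x$- and $u$-operators commute; they act entrywise on matrices. **Weight and OPS.** $w(x;u)$ is a weight on a lattice support $G$ (with $\int_G\mathbb Dx\,h=\sum_s\Delta y(x_s)h(x_s)$). $p_n(x;u)=\gamma_n(u)x^n+\cdots$ are orthonormal, $\int_G\mathbb Dx\,w\,p_mp_n=\delta_{mn}$, $p_{-1}=0$; $q_n(x;u)=\int_G\mathbb Dy\,w(y;u)\frac{p_n(y;u)}{x-y}$ for $n\ge0$; $a_n=\gamma_{n-1}/\gamma_n$ ($n\ge1$), $a_0\ne0$ arbitrary, $q_{-1}=1/(a_0\gamma_0)$. $Y_n(x;u)=\begin{pmatrix} p_n & q_n/w \\ p_{n-1} & q_{n-1}/w \end{pmatrix}$, $\det Y_n=1/(a_nw)$. **Deformed $\mathbb D$-semi-classical weight:** $w(y_+;u)/w(y_-;u)=\frac{W+\Delta yV}{W-\Delta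 yV}(x;u)$ and $w(x;v_+)/w(x;v_-)=\frac{R+\Delta vS}{R-\Delta vS}(x;u)$ with $W,V,R,S$ polynomials in $x$, $W\pm\Delta yV\ne0$ and $R\pm\Delta vS\neq0$ for $x\in G$, $\gamma_n(v_\pm)\ne0$ for all $n$, and $\gamma_0(v_+)(R-\Delta vS)+\gamma_0(v_-)(R+\Delta vS)\ne0$. **Spectral and deformation matrices.** $A_n$ and $B_n$ are the matrices, rational in $x$, with $\mathbb D_xY_n=A_n\mathbb M_xY_n$ and $\mathbb D_uY_n=B_n\mathbb M_uY_n$, i.e. $A_n=(\mathbb D_xY_n)(\mathbb M_xY_n)^{-1}$, $B_n=(\mathbb D_uY_n)(\mathbb M_uY_n)^{-1}$. Here $1$ is the $2\times2$ identity, and identities are understood where the displayed inverses exist. *)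

theory Defs
  imports "HOL-Analysis.Analysis" "HOL-Computational_Algebra.Polynomial"
begin

section \<open>Lattices and their divided-difference operators\<close>

text \<open>
  A lattice is a symmetric conic together with a labelling
  \<open>up = \<iota>\<^sub>+\<close>, \<open>dn = \<iota>\<^sub>-\<close> of its two roots.
\<close>

record lattice =
  cA :: complex
  cB :: complex
  cD :: complex
  cF :: complex
  up :: "complex \<Rightarrow> complex"
  dn :: "complex \<Rightarrow> complex"

text \<open>
  The factorisation says that \<open>up x\<close> and \<open>dn x\<close> are the two roots counted
  with multiplicity. Which root is called \<open>up x\<close> is left free for each \<open>x\<close>.
\<close>

definition is_lattice :: "lattice \<Rightarrow> bool" where
  "is_lattice L \<longleftrightarrow> cA L \<noteq> 0 \<and>
     (\<forall>x y. cA L * y^2 + 2 * cB L * x * y + cA L * x^2 + 2 * cD L * (x + y) + cF L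
            = cA L * (y - up L x) * (y - dn L x))"

definition gap :: "lattice \<Rightarrow> complex \<Rightarrow> complex" where
  "gap L x = up L x - dn L x"

definition divdiff :: "lattice \<Rightarrow> (complex \<Rightarrow> complex) \<Rightarrow> complex \<Rightarrow> complex" where
  "divdiff L h x = (h (up L x) - h (dn L x)) / gap L x"

definition mean :: "lattice \<Rightarrow> (complex \<Rightarrow> complex) \<Rightarrow> complex \<Rightarrow> complex" where
  "mean L h x = (h (up L x) + h (dn L x)) / 2"

type_synonym mat2 = "complex^2^2"

definition mscale :: "complex \<Rightarrow> mat2 \<Rightarrow> mat2" (infixr "*\<^sub>m" 75) where
  "c *\<^sub>m M = map_matrix ((*) c) M"

text \<open>Entrywise action on matrix functions \<open>H x u\<close>, in the first and in the second variable.\<close>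

definition Dx :: "lattice \<Rightarrow> (complex \<Rightarrow> complex \<Rightarrow> mat2) \<Rightarrow> complex \<Rightarrow> complex \<Rightarrow> mat2" where
  "Dx L H x u = (\<chi> i j. divdiff L (\<lambda>x'. H x' u $ i $ j) x)"

definition Mx :: "lattice \<Rightarrow> (complex \<Rightarrow> complex \<Rightarrow> mat2) \<Rightarrow> complex \<Rightarrow> complex \<Rightarrow> mat2" where
  "Mx L H x u = (\<chi> i j. mean L (\<lambda>x'. H x' u $ i $ j) x)"

definition Du :: "lattice \<Rightarrow> (complex \<Rightarrow> complex \<Rightarrow> mat2) \<Rightarrow> complex \<Rightarrow> complex \<Rightarrow> mat2" where
  "Du K H x u = (\<chi> i j. divdiff K (\<lambda>u'. H x u' $ i $ j) u)"

definition Mu :: "lattice \<Rightarrow> (complex \<Rightarrow> complex \<Rightarrow> mat2) \<Rightarrow> complex \<Rightarrow> complex \<Rightarrow> mat2" where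
  "Mu K H x u = (\<chi> i j. mean K (\<lambda>u'. H x u' $ i $ j) u)"


section \<open>Orthogonal polynomial systems on a lattice\<close>

text \<open>
  \<open>params\<close> is the set of parameter values at which the weight and its
  polynomials are considered; \<open>a0\<close> is the arbitrary nonzero constant \<open>a\<^sub>0\<close>, which
  may depend on the parameter. The support is \<open>{x\<^sub>s | s \<in> index}\<close> with
  \<open>x\<^sub>s = node s\<close>.
\<close>

record ops =
  index :: "int set"
  node :: "int \<Rightarrow> complex"
  params :: "complex set"
  weight :: "complex \<Rightarrow> complex \<Rightarrow> complex"
  p :: "nat \<Rightarrow> complex \<Rightarrow> complex poly"
  a0 :: "complex \<Rightarrow> complex"
  W :: "complex \<Rightarrow> complex poly"
  V :: "complex \<Rightarrow> complex poly"
  R :: "complex \<Rightarrow> complex poly"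
  S :: "complex \<Rightarrow> complex poly"

definition support :: "ops \<Rightarrow> complex set" where
  "support E = node E ` index E"

text \<open>
  The index set is an interval of integers, and consecutive nodes share an
  intermediate point, \<open>\<iota>\<^sub>+(x\<^sub>s) = \<iota>\<^sub>-(x\<^sub>s\<^sub>+\<^sub>1)\<close>.
\<close>

definition lattice_support :: "lattice \<Rightarrow> ops \<Rightarrow> bool" where
  "lattice_support L E \<longleftrightarrow>
     (\<forall>r\<in>index E. \<forall>t\<in>index E. {r..t} \<subseteq> index E) \<and>
     (\<forall>s. s \<in> index E \<and> s + 1 \<in> index E \<longrightarrow> up L (node E s) = dn L (node E (s + 1)))"

definition D_integrable :: "lattice \<Rightarrow> ops \<Rightarrow> (complex \<Rightarrow> complex) \<Rightarrow> bool" where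
  "D_integrable L E h \<longleftrightarrow> (\<lambda>s. gap L (node E s) * h (node E s)) summable_on index E"

definition D_integral :: "lattice \<Rightarrow> ops \<Rightarrow> (complex \<Rightarrow> complex) \<Rightarrow> complex" where
  "D_integral L E h = (\<Sum>\<^sub>\<infinity>s\<in>index E. gap L (node E s) * h (node E s))"

definition leadc :: "ops \<Rightarrow> nat \<Rightarrow> complex \<Rightarrow> complex" where
  "leadc E n u = coeff (p E n u) n"

definition orthonormal_system :: "lattice \<Rightarrow> ops \<Rightarrow> bool" where
  "orthonormal_system L E \<longleftrightarrow>
     (\<forall>u\<in>params E.
        a0 E u \<noteq> 0 \<and>
        (\<forall>n. degree (p E n u) \<le> n) \<and>
        (\<forall>m n. D_integrable L E (\<lambda>x. weight E x u * poly (p E m u) x * poly (p E n u) x) \<and>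
               D_integral L E (\<lambda>x. weight E x u * poly (p E m u) x * poly (p E n u) x)
                 = (if m = n then 1 else 0)))"

definition q_integrand :: "ops \<Rightarrow> nat \<Rightarrow> complex \<Rightarrow> complex \<Rightarrow> complex \<Rightarrow> complex" where
  "q_integrand E n x u y = weight E y u * (poly (p E n u) y / (x - y))"

definition q :: "lattice \<Rightarrow> ops \<Rightarrow> nat \<Rightarrow> complex \<Rightarrow> complex \<Rightarrow> complex" where
  "q L E n x u = D_integral L E (q_integrand E n x u)"

text \<open>The second row for \<open>n = 0\<close> uses \<open>p\<^sub>-\<^sub>1 = 0\<close> and \<open>q\<^sub>-\<^sub>1 = 1 / (a\<^sub>0 \<gamma>\<^sub>0)\<close>.\<close>

definition p_prev :: "ops \<Rightarrow> nat \<Rightarrow> complex \<Rightarrow> complex \<Rightarrow> complex" where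
  "p_prev E n x u = (case n of 0 \<Rightarrow> 0 | Suc m \<Rightarrow> poly (p E m u) x)"

definition q_prev :: "lattice \<Rightarrow> ops \<Rightarrow> nat \<Rightarrow> complex \<Rightarrow> complex \<Rightarrow> complex" where
  "q_prev L E n x u = (case n of 0 \<Rightarrow> 1 / (a0 E u * leadc E 0 u) | Suc m \<Rightarrow> q L E m x u)"

definition Y :: "lattice \<Rightarrow> ops \<Rightarrow> nat \<Rightarrow> complex \<Rightarrow> complex \<Rightarrow> mat2" where
  "Y L E n x u =
     vector [vector [poly (p E n u) x, q L E n x u / weight E x u],
             vector [p_prev E n x u,   q_prev L E n x u / weight E x u]]"

text \<open>
  The points at which the formula for \<open>Y\<^sub>n\<close> makes sense: no division by zero
  and convergent integrals for \<open>q\<^sub>n\<close> and \<open>q\<^sub>n\<^sub>-\<^sub>1\<close>.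
\<close>

definition Y_defined :: "lattice \<Rightarrow> ops \<Rightarrow> nat \<Rightarrow> complex \<Rightarrow> complex \<Rightarrow> bool" where
  "Y_defined L E n x u \<longleftrightarrow>
     u \<in> params E \<and> x \<notin> support E \<and> weight E x u \<noteq> 0 \<and>
     D_integrable L E (q_integrand E n x u) \<and>
     (\<forall>m. n = Suc m \<longrightarrow> D_integrable L E (q_integrand E m x u))"


section \<open>Deformed semi-classical systems\<close>

text \<open>
  Quotients are equated only where both denominators are nonzero.
\<close>

definition x_semi_classical :: "lattice \<Rightarrow> ops \<Rightarrow> bool" where
  "x_semi_classical L E \<longleftrightarrow>
     (\<forall>u\<in>params E.
        (\<forall>x. weight E (dn L x) u \<noteq> 0 \<and> poly (W E u) x - gap L x * poly (V E u) x \<noteq> 0 \<longrightarrow>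
             weight E (up L x) u / weight E (dn L x) u
             = (poly (W E u) x + gap L x * poly (V E u) x)
               / (poly (W E u) x - gap L x * poly (V E u) x)) \<and>
        (\<forall>x\<in>support E. poly (W E u) x + gap L x * poly (V E u) x \<noteq> 0 \<and>
                       poly (W E u) x - gap L x * poly (V E u) x \<noteq> 0))"

text \<open>
  The last condition, on \<open>\<gamma>\<^sub>0(v\<^sub>+)(R - \<Delta>v S) + \<gamma>\<^sub>0(v\<^sub>-)(R + \<Delta>v S)\<close>, is that this
  polynomial in \<open>x\<close> is not the zero polynomial.
\<close>

definition u_semi_classical :: "lattice \<Rightarrow> ops \<Rightarrow> bool" where
  "u_semi_classical K E \<longleftrightarrow>
     (\<forall>u. up K u \<in> params E \<and> dn K u \<in> params E \<longrightarrow>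
        (\<forall>x. weight E x (dn K u) \<noteq> 0 \<and> poly (R E u) x - gap K u * poly (S E u) x \<noteq> 0 \<longrightarrow>
             weight E x (up K u) / weight E x (dn K u)
             = (poly (R E u) x + gap K u * poly (S E u) x)
               / (poly (R E u) x - gap K u * poly (S E u) x)) \<and>
        (\<forall>x\<in>support E. poly (R E u) x + gap K u * poly (S E u) x \<noteq> 0 \<and>
                       poly (R E u) x - gap K u * poly (S E u) x \<noteq> 0) \<and>
        (\<forall>n. leadc E n (up K u) \<noteq> 0 \<and> leadc E n (dn K u) \<noteq> 0) \<and>
        smult (leadc E 0 (up K u)) (R E u - smult (gap K u) (S E u))
          + smult (leadc E 0 (dn K u)) (R E u + smult (gap K u) (S E u)) \<noteq> 0)"

text \<open>\<open>L\<close> is the lattice of the variable \<open>x\<close> and \<open>K\<close> that of the deformation variable \<open>u\<close>.\<close>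

definition deformed_semi_classical :: "lattice \<Rightarrow> lattice \<Rightarrow> ops \<Rightarrow> bool" where
  "deformed_semi_classical L K E \<longleftrightarrow>
     is_lattice L \<and> is_lattice K \<and> lattice_support L E \<and>
     orthonormal_system L E \<and> x_semi_classical L E \<and> u_semi_classical K E"

definition spectral_matrix :: "lattice \<Rightarrow> ops \<Rightarrow> nat \<Rightarrow> complex \<Rightarrow> complex \<Rightarrow> mat2" where
  "spectral_matrix L E n x u = Dx L (Y L E n) x u ** matrix_inv (Mx L (Y L E n) x u)"

definition deformation_matrix ::
    "lattice \<Rightarrow> lattice \<Rightarrow> ops \<Rightarrow> nat \<Rightarrow> complex \<Rightarrow> complex \<Rightarrow> mat2" where
  "deformation_matrix L K E n x u = Du K (Y L E n) x u ** matrix_inv (Mu K (Y L E n) x u)"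

end

theory Submission
  imports Defs
begin

text \<open>
  Write \<open>a\<^sub>\<plusminus> = (\<Delta>y/2) A(x; v\<^sub>\<plusminus>)\<close> and \<open>b\<^sub>\<plusminus> = (\<Delta>v/2) B(y\<^sub>\<plusminus>; u)\<close>. The defining relations of \<open>A\<close>
  and \<open>B\<close> say \<open>(1 - a) Y\<^sub>+ = (1 + a) Y\<^sub>-\<close> along each of the four edges of the square formed by the
  corners \<open>(y\<^sub>\<plusminus>, v\<^sub>\<plusminus>)\<close>. The product form expresses that the two paths from \<open>(y\<^sub>-, v\<^sub>-)\<close> to
  \<open>(y\<^sub>+, v\<^sub>+)\<close> give the same value of \<open>Y\<close>.
  For the other form, pass to the sum \<open>P\<close> of the four corner values, the differences \<open>X\<close> and \<open>U\<close> in
  each direction and the mixed difference \<open>Z\<close>. With \<open>\<alpha>, \<alpha>'\<close> half the sum and difference of \<open>a\<^sub>\<plusminus>\<close>,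
  and \<open>\<beta>, \<beta>'\<close> likewise for \<open>b\<^sub>\<plusminus>\<close>, the edge relations become \<open>X = \<alpha>P + \<alpha>'U\<close>, \<open>Z = \<alpha>'P + \<alpha>U\<close>,
  \<open>U = \<beta>P + \<beta>'X\<close>, \<open>Z = \<beta>'P + \<beta>X\<close>. Solving for \<open>X\<close> and \<open>U\<close> in terms of \<open>P\<close> and equating the two
  expressions for \<open>Z\<close> gives the equation. Invertibility of every matrix that has to be cancelled
  follows from that of the averages of \<open>Y\<close>.
\<close>

section \<open>Matrix algebra over a field\<close>

lemma matrix_inv_mult:
  fixes M :: "'a::field^'n^'n"
  assumes "invertible M"
  shows "matrix_inv M ** M = mat 1" "M ** matrix_inv M = mat 1"
  using someI_ex[OF assms[unfolded invertible_def]] by (simp_all add: matrix_inv_def)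

lemma matrix_distribs:
  fixes M N Q :: "'a::field^'n^'n"
  shows "M ** (N + Q) = M ** N + M ** Q" "(M + N) ** Q = M ** Q + N ** Q"
    "M ** (N - Q) = M ** N - M ** Q" "(M - N) ** Q = M ** Q - N ** Q"
  by (simp_all add: matrix_matrix_mult_def vec_eq_iff algebra_simps sum.distrib sum_subtractf)

lemma invertible_mult_right_factor:
  fixes M N :: "'a::field^'n^'n"
  assumes "invertible (M ** N)"
  shows "invertible N"
  using assms unfolding invertible_det_nz by (simp add: det_mul)

lemma invertible_right_cancel:
  fixes M N Q :: "'a::field^'n^'n"
  assumes "invertible Q" "M ** Q = N ** Q"
  shows "M = N"
  by (metis assms matrix_inv_mult(2) matrix_mul_assoc matrix_mul_rid)

lemma invertible_solve:
  fixes M N Q :: "'a::field^'n^'n"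
  assumes "invertible M" "M ** Q = N"
  shows "Q = matrix_inv M ** N"
  by (metis assms matrix_inv_mult(1) matrix_mul_assoc matrix_mul_lid)

text \<open>Push-through: \<open>(1 - MN)M = M(1 - NM)\<close>, so \<open>1 - MN\<close> sends
  \<open>M(1 - NM)^-1 N\<close> to \<open>MN\<close>, exactly what it takes away from
  \<open>1\<close>.\<close>

lemma matrix_inv_one_minus_mult:
  fixes M N :: "'a::field^'n^'n"
  assumes "invertible (mat 1 - M ** N)" "invertible (mat 1 - N ** M)"
  shows "matrix_inv (mat 1 - M ** N) = mat 1 + M ** matrix_inv (mat 1 - N ** M) ** N"
proof -
  let ?J = "matrix_inv (mat 1 - N ** M)"
  have "(mat 1 - M ** N) ** (M ** ?J ** N) = M ** ((mat 1 - N ** M) ** ?J) ** N"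
    by (simp add: matrix_distribs matrix_mul_assoc)
  also have "\<dots> = M ** N"
    by (simp add: matrix_inv_mult(2)[OF assms(2)])
  finally have "(mat 1 - M ** N) ** (mat 1 + M ** ?J ** N) = mat 1"
    by (simp add: matrix_distribs)
  from invertible_solve[OF assms(1) this] show ?thesis
    by simp
qed

lemma schlesinger_of_edge_relations:
  fixes \<alpha> \<alpha>' \<beta> \<beta>' P X U Z :: "'a::field^'n^'n"
  assumes X: "X = \<alpha> ** P + \<alpha>' ** U" and Z: "Z = \<alpha>' ** P + \<alpha> ** U"
    and U: "U = \<beta> ** P + \<beta>' ** X" and Z': "Z = \<beta>' ** P + \<beta> ** X"
    and inv: "invertible (P + U)"
    and inv_ba: "invertible (mat 1 - \<beta>' ** \<alpha>')" and inv_ab: "invertible (mat 1 - \<alpha>' ** \<beta>')"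
  shows "\<alpha>' - \<beta>' + \<alpha> ** \<beta> - \<beta> ** \<alpha>
    = \<beta> ** \<alpha>' ** matrix_inv (mat 1 - \<beta>' ** \<alpha>') ** (\<beta> + \<beta>' ** \<alpha>)
      - \<alpha> ** \<beta>' ** matrix_inv (mat 1 - \<alpha>' ** \<beta>') ** (\<alpha> + \<alpha>' ** \<beta>)"
proof -
  let ?I = "matrix_inv (mat 1 - \<beta>' ** \<alpha>')" and ?J = "matrix_inv (mat 1 - \<alpha>' ** \<beta>')"
  note distribs = matrix_distribs matrix_mul_assoc
  have "X = \<alpha> ** P + \<alpha>' ** (\<beta> ** P + \<beta>' ** X)"
    using X U by simp
  then have "(mat 1 - \<alpha>' ** \<beta>') ** X = (\<alpha> + \<alpha>' ** \<beta>) ** P"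
    by (simp add: distribs algebra_simps)
  from invertible_solve[OF inv_ab this] have X': "X = ?J ** (\<alpha> + \<alpha>' ** \<beta>) ** P"
    by (simp add: matrix_mul_assoc)
  have "U = \<beta> ** P + \<beta>' ** (\<alpha> ** P + \<alpha>' ** U)"
    using X U by simp
  then have "(mat 1 - \<beta>' ** \<alpha>') ** U = (\<beta> + \<beta>' ** \<alpha>) ** P"
    by (simp add: distribs algebra_simps)
  from invertible_solve[OF inv_ba this] have U': "U = ?I ** (\<beta> + \<beta>' ** \<alpha>) ** P"
    by (simp add: matrix_mul_assoc)
  \<comment> \<open>\<open>U\<close> is a left multiple of \<open>P\<close>, so \<open>P\<close> is
    a right factor of the invertible \<open>P + U\<close> and can be cancelled from the two values
    of \<open>Z\<close>.\<close>
  have "P + U = (mat 1 + ?I ** (\<beta> + \<beta>' ** \<alpha>)) ** P"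
    by (subst U') (simp add: matrix_distribs)
  with inv have inv_P: "invertible P"
    by (metis invertible_mult_right_factor)
  have "(\<alpha>' + \<alpha> ** (?I ** (\<beta> + \<beta>' ** \<alpha>))) ** P = Z"
    by (subst Z, subst U') (simp add: matrix_distribs matrix_mul_assoc)
  also have "\<dots> = (\<beta>' + \<beta> ** (?J ** (\<alpha> + \<alpha>' ** \<beta>))) ** P"
    by (subst Z', subst X') (simp add: matrix_distribs matrix_mul_assoc)
  finally have main: "\<alpha>' + \<alpha> ** (?I ** (\<beta> + \<beta>' ** \<alpha>)) = \<beta>' + \<beta> ** (?J ** (\<alpha> + \<alpha>' ** \<beta>))"
    by (rule invertible_right_cancel[OF inv_P])
  \<comment> \<open>Splits the products \<open>\<alpha> ** \<beta>\<close> and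
    \<open>\<beta> ** \<alpha>\<close> off the two sides of \<open>main\<close> and reverses the
    order inside each inverse; what remains on either side is a correction term of the
    claim.\<close>
  have push: "M ** (matrix_inv (mat 1 - Q ** N) ** (T + Q ** M)) =
      M ** T + M ** Q ** matrix_inv (mat 1 - N ** Q) ** (M + N ** T)"
    if "invertible (mat 1 - Q ** N)" "invertible (mat 1 - N ** Q)"
    for M N Q T :: "'a^'n^'n"
  proof -
    have "mat 1 + matrix_inv (mat 1 - N ** Q) ** N ** Q = matrix_inv (mat 1 - N ** Q)"
      using matrix_inv_mult(1)[OF that(2)]
      by (simp add: matrix_distribs matrix_mul_assoc algebra_simps)
    then have "M ** Q ** (mat 1 + matrix_inv (mat 1 - N ** Q) ** N ** Q) ** M
        = M ** Q ** matrix_inv (mat 1 - N ** Q) ** M"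
      by simp
    then show ?thesis
      by (simp add: matrix_inv_one_minus_mult[OF that] distribs algebra_simps)
  qed
  show ?thesis
    using main unfolding push[OF inv_ba inv_ab] push[OF inv_ab inv_ba]
    by (simp add: algebra_simps)
qed

section \<open>Scalar multiples and the relation along one edge\<close>

lemma mscale_simps:
  "(c *\<^sub>m M) ** N = c *\<^sub>m (M ** N)"
  "M ** (c *\<^sub>m N) = c *\<^sub>m (M ** N)"
  "c *\<^sub>m (d *\<^sub>m M) = (c * d) *\<^sub>m M"
  "c *\<^sub>m (M + N) = c *\<^sub>m M + c *\<^sub>m N"
  "c *\<^sub>m (M - N) = c *\<^sub>m M - c *\<^sub>m N"
  "1 *\<^sub>m M = M"
  by (simp_all add: mscale_def map_matrix_def matrix_matrix_mult_def vec_eq_iff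
      sum_distrib_left algebra_simps)

lemma mscale_cancel: "c \<noteq> 0 \<Longrightarrow> c *\<^sub>m M = c *\<^sub>m N \<Longrightarrow> M = N"
  by (simp add: mscale_def map_matrix_def vec_eq_iff)

lemma Dx_Mx_Du_Mu_eq_mscale:
  "Dx L H x u = (1 / gap L x) *\<^sub>m (H (up L x) u - H (dn L x) u)"
  "Mx L H x u = (1 / 2) *\<^sub>m (H (up L x) u + H (dn L x) u)"
  "Du K H x u = (1 / gap K u) *\<^sub>m (H x (up K u) - H x (dn K u))"
  "Mu K H x u = (1 / 2) *\<^sub>m (H x (up K u) + H x (dn K u))"
  by (simp_all add: Dx_def Mx_def Du_def Mu_def mscale_def map_matrix_def divdiff_def mean_def
      vec_eq_iff)

text \<open>With \<open>d\<close> the gap of the lattice, \<open>C\<close> is a divided difference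
  times an inverse mean. Multiplying by the mean cancels the inverse, and \<open>d / 2\<close> turns
  quotient and mean back into difference and sum.\<close>

lemma edge_relation:
  assumes "d \<noteq> 0" and inv: "invertible ((1 / 2) *\<^sub>m (M + N))"
    and C: "C = ((1 / d) *\<^sub>m (M - N)) ** matrix_inv ((1 / 2) *\<^sub>m (M + N))"
  shows "((d / 2) *\<^sub>m C) ** (M + N) = M - N"
proof -
  have "((d / 2) *\<^sub>m C) ** (M + N) = d *\<^sub>m (C ** ((1 / 2) *\<^sub>m (M + N)))"
    by (simp only: mscale_simps(1-3)) simp
  also have "C ** ((1 / 2) *\<^sub>m (M + N)) = (1 / d) *\<^sub>m (M - N)"
    by (simp only: C matrix_mul_assoc[symmetric] matrix_inv_mult(1)[OF inv] matrix_mul_rid)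
  finally show ?thesis
    using \<open>d \<noteq> 0\<close> by (simp only: mscale_simps(3)) (simp add: mscale_simps(6))
qed

lemma edge_transfer:
  fixes c M N :: "'a::field^'n^'n"
  assumes c: "c ** (M + N) = M - N" and "invertible (mat 1 - c)"
  shows "M = matrix_inv (mat 1 - c) ** (mat 1 + c) ** N"
proof -
  have "(mat 1 - c) ** M = (mat 1 + c) ** N"
    using c by (simp add: matrix_distribs algebra_simps)
  from invertible_solve[OF assms(2) this] show ?thesis
    by (simp add: matrix_mul_assoc)
qed

text \<open>Subtracting the relation from \<open>M + N\<close> leaves
  \<open>(1 - c)(M + N) = 2N\<close>, so \<open>N\<close> is a product of invertible
  matrices.\<close>

lemma invertible_edge_end:
  fixes M N c :: mat2
  assumes c: "c ** (M + N) = M - N" and "invertible (mat 1 - c)"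
    and inv: "invertible ((1 / 2) *\<^sub>m (M + N))"
  shows "invertible N"
proof -
  have "(mat 1 - c) ** (M + N) = N + N"
    by (simp add: matrix_distribs(4) c)
  then have "(mat 1 - c) ** ((1 / 2) *\<^sub>m (M + N)) = (1 / 2) *\<^sub>m (N + N)"
    by (simp only: mscale_simps(2))
  also have "\<dots> = N"
    by (simp add: mscale_def map_matrix_def vec_eq_iff)
  finally show ?thesis
    using invertible_mult[OF assms(2) inv] by simp
qed

text \<open>The two forms are derived separately, each assuming invertibility of just the matrices
  whose inverses it displays.\<close>

theorem proposition6p11:
  fixes L K :: lattice and E :: ops and n :: nat and x u :: complex
    and A B :: "complex \<Rightarrow> complex \<Rightarrow> mat2"
    and dy dv yp ym vp vm :: complex
  assumes system: "deformed_semi_classical L K E"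
    and A: "A = spectral_matrix L E n"
    and B: "B = deformation_matrix L K E n"
    and y: "yp = up L x" "ym = dn L x" "dy = gap L x" "dy \<noteq> 0"
    and v: "vp = up K u" "vm = dn K u" "dv = gap K u" "dv \<noteq> 0"
    and Y_defined: "\<forall>y\<in>{yp, ym}. \<forall>v\<in>{vp, vm}. Y_defined L E n y v"
    and A_defined: "\<forall>v\<in>{vp, vm}. invertible (Mx L (Y L E n) x v)"
    and B_defined: "\<forall>y\<in>{yp, ym}. invertible (Mu K (Y L E n) y u)"
  shows
    "(invertible (mat 1 - (1/16 * dy^2 * dv^2) *\<^sub>m (Dx L B x u ** Du K A x u)) \<and>
      invertible (mat 1 - (1/16 * dy^2 * dv^2) *\<^sub>m (Du K A x u ** Dx L B x u)) \<longrightarrow>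
        Du K A x u - Dx L B x u + Mu K A x u ** Mx L B x u - Mx L B x u ** Mu K A x u
        = (1/4 * dv^2) *\<^sub>m
            (Mx L B x u ** Du K A x u
             ** matrix_inv (mat 1 - (1/16 * dy^2 * dv^2) *\<^sub>m (Dx L B x u ** Du K A x u))
             ** (Mx L B x u + (1/4 * dy^2) *\<^sub>m (Dx L B x u ** Mu K A x u)))
          - (1/4 * dy^2) *\<^sub>m
            (Mu K A x u ** Dx L B x u
             ** matrix_inv (mat 1 - (1/16 * dy^2 * dv^2) *\<^sub>m (Du K A x u ** Dx L B x u))
             ** (Mu K A x u + (1/4 * dv^2) *\<^sub>m (Du K A x u ** Mx L B x u))))
     \<and>
     (invertible (mat 1 - (dy/2) *\<^sub>m A x vp) \<and> invertible (mat 1 - (dv/2) *\<^sub>m B ym u) \<and>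
      invertible (mat 1 - (dv/2) *\<^sub>m B yp u) \<and> invertible (mat 1 - (dy/2) *\<^sub>m A x vm) \<longrightarrow>
        matrix_inv (mat 1 - (dy/2) *\<^sub>m A x vp) ** (mat 1 + (dy/2) *\<^sub>m A x vp)
        ** matrix_inv (mat 1 - (dv/2) *\<^sub>m B ym u) ** (mat 1 + (dv/2) *\<^sub>m B ym u)
        = matrix_inv (mat 1 - (dv/2) *\<^sub>m B yp u) ** (mat 1 + (dv/2) *\<^sub>m B yp u)
          ** matrix_inv (mat 1 - (dy/2) *\<^sub>m A x vm) ** (mat 1 + (dy/2) *\<^sub>m A x vm))"
proof -
  define Yn where "Yn = Y L E n"
  define a b c d where "a = (dy / 2) *\<^sub>m A x vp" and "b = (dy / 2) *\<^sub>m A x vm"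
    and "c = (dv / 2) *\<^sub>m B yp u" and "d = (dv / 2) *\<^sub>m B ym u"
  define Ypp Ypm Ymp Ymm where "Ypp = Yn yp vp" and "Ypm = Yn yp vm"
    and "Ymp = Yn ym vp" and "Ymm = Yn ym vm"
  note defs = Ypp_def Ypm_def Ymp_def Ymm_def Yn_def
  have inv_a: "invertible ((1 / 2) *\<^sub>m (Ypp + Ymp))" and inv_b: "invertible ((1 / 2) *\<^sub>m (Ypm + Ymm))"
    using A_defined by (simp_all add: Dx_Mx_Du_Mu_eq_mscale defs y)
  have inv_c: "invertible ((1 / 2) *\<^sub>m (Ypp + Ypm))" and inv_d: "invertible ((1 / 2) *\<^sub>m (Ymp + Ymm))"
    using B_defined by (simp_all add: Dx_Mx_Du_Mu_eq_mscale defs v)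
  have a: "a ** (Ypp + Ymp) = Ypp - Ymp"
    unfolding a_def by (rule edge_relation[OF y(4) inv_a])
      (simp add: A spectral_matrix_def Dx_Mx_Du_Mu_eq_mscale defs y)
  have b: "b ** (Ypm + Ymm) = Ypm - Ymm"
    unfolding b_def by (rule edge_relation[OF y(4) inv_b])
      (simp add: A spectral_matrix_def Dx_Mx_Du_Mu_eq_mscale defs y)
  have c: "c ** (Ypp + Ypm) = Ypp - Ypm"
    unfolding c_def by (rule edge_relation[OF v(4) inv_c])
      (simp add: B deformation_matrix_def Dx_Mx_Du_Mu_eq_mscale defs v)
  have d: "d ** (Ymp + Ymm) = Ymp - Ymm"
    unfolding d_def by (rule edge_relation[OF v(4) inv_d])
      (simp add: B deformation_matrix_def Dx_Mx_Du_Mu_eq_mscale defs v)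

  have product_form: "matrix_inv (mat 1 - a) ** (mat 1 + a) ** matrix_inv (mat 1 - d) ** (mat 1 + d)
      = matrix_inv (mat 1 - c) ** (mat 1 + c) ** matrix_inv (mat 1 - b) ** (mat 1 + b)"
    if "invertible (mat 1 - a)" "invertible (mat 1 - d)"
      "invertible (mat 1 - c)" "invertible (mat 1 - b)"
  proof (rule invertible_right_cancel)
    \<comment> \<open>Applied to the starting corner \<open>Ymm\<close>, both products give
      \<open>Ypp\<close>.\<close>
    show "invertible Ymm"
      using invertible_edge_end[OF b that(4) inv_b] .
    show "matrix_inv (mat 1 - a) ** (mat 1 + a) ** matrix_inv (mat 1 - d) ** (mat 1 + d) ** Ymm
      = matrix_inv (mat 1 - c) ** (mat 1 + c) ** matrix_inv (mat 1 - b) ** (mat 1 + b) ** Ymm"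
      using edge_transfer[OF a that(1)] edge_transfer[OF d that(2)]
        edge_transfer[OF c that(3)] edge_transfer[OF b that(4)]
      by (metis matrix_mul_assoc)
  qed

  \<comment> \<open>The mean keeps the single factor \<open>dy / 2\<close> or \<open>dv / 2\<close>;
    the divided difference also needs half of the other gap. Hence the \<open>1/16\<close> in
    \<open>\<beta>' ** \<alpha>'\<close>.\<close>
  define \<alpha> \<alpha>' \<beta> \<beta>' where "\<alpha> = (dy / 2) *\<^sub>m Mu K A x u" and "\<alpha>' = (dy * dv / 4) *\<^sub>m Du K A x u"
    and "\<beta> = (dv / 2) *\<^sub>m Mx L B x u" and "\<beta>' = (dy * dv / 4) *\<^sub>m Dx L B x u"
  have \<alpha>: "\<alpha> = (1 / 2) *\<^sub>m (a + b)" and \<beta>: "\<beta> = (1 / 2) *\<^sub>m (c + d)"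
    by (simp_all add: \<alpha>_def \<beta>_def a_def b_def c_def d_def Dx_Mx_Du_Mu_eq_mscale mscale_simps y(1,2) v(1,2))
  have \<alpha>': "\<alpha>' = (1 / 2) *\<^sub>m (a - b)" and \<beta>': "\<beta>' = (1 / 2) *\<^sub>m (c - d)"
    using y(4) v(4)
    by (simp_all add: \<alpha>'_def \<beta>'_def a_def b_def c_def d_def Dx_Mx_Du_Mu_eq_mscale mscale_simps
        y(1,2) v(1,2) flip: y(3) v(3))
  define P X U Z where "P = Ypp + Ypm + Ymp + Ymm" and "X = Ypp + Ypm - Ymp - Ymm"
    and "U = Ypp - Ypm + Ymp - Ymm" and "Z = Ypp - Ypm - Ymp + Ymm"
  \<comment> \<open>For edge coefficients \<open>M\<close>, \<open>N\<close> and edge sums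
    \<open>F\<close>, \<open>G\<close>, this and \<open>halves'\<close> rewrite the sum and the
    difference of two opposite edge relations.\<close>
  have halves: "((1 / 2) *\<^sub>m (M + N)) ** (F + G) + ((1 / 2) *\<^sub>m (M - N)) ** (F - G) = M ** F + N ** G"
    for M N F G :: mat2
  proof -
    have "((1 / 2) *\<^sub>m (M + N)) ** (F + G) + ((1 / 2) *\<^sub>m (M - N)) ** (F - G)
      = (1 / 2) *\<^sub>m ((M ** F + N ** G) + (M ** F + N ** G))"
      by (simp only: mscale_simps(1) flip: mscale_simps(4))
        (simp add: matrix_distribs)
    also have "\<dots> = M ** F + N ** G"
      by (simp add: mscale_def map_matrix_def vec_eq_iff)
    finally show ?thesis .
  qed
  have halves': "((1 / 2) *\<^sub>m (M - N)) ** (F + G) + ((1 / 2) *\<^sub>m (M + N)) ** (F - G) = M ** F - N ** G"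
    for M N F G :: mat2
  proof -
    have "((1 / 2) *\<^sub>m (M - N)) ** (F + G) + ((1 / 2) *\<^sub>m (M + N)) ** (F - G)
      = (1 / 2) *\<^sub>m ((M ** F - N ** G) + (M ** F - N ** G))"
      by (simp only: mscale_simps(1) flip: mscale_simps(4))
        (simp add: matrix_distribs)
    also have "\<dots> = M ** F - N ** G"
      by (simp add: mscale_def map_matrix_def vec_eq_iff)
    finally show ?thesis .
  qed
  have X_eq: "X = \<alpha> ** P + \<alpha>' ** U"
    using halves[of a b "Ypp + Ymp" "Ypm + Ymm"]
    unfolding a b by (simp add: \<alpha> \<alpha>' P_def X_def U_def algebra_simps)
  have Z_eq: "Z = \<alpha>' ** P + \<alpha> ** U"
    using halves'[of a b "Ypp + Ymp" "Ypm + Ymm"]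
    unfolding a b by (simp add: \<alpha> \<alpha>' P_def Z_def U_def algebra_simps)
  have U_eq: "U = \<beta> ** P + \<beta>' ** X"
    using halves[of c d "Ypp + Ypm" "Ymp + Ymm"]
    unfolding c d by (simp add: \<beta> \<beta>' P_def X_def U_def algebra_simps)
  have Z_eq': "Z = \<beta>' ** P + \<beta> ** X"
    using halves'[of c d "Ypp + Ypm" "Ymp + Ymm"]
    unfolding c d by (simp add: \<beta> \<beta>' P_def X_def Z_def algebra_simps)
  \<comment> \<open>The corners at \<open>vm\<close> cancel in \<open>P + U\<close>, leaving four
    times the \<open>x\<close>-mean at \<open>vp\<close>, which is invertible.\<close>
  have "P + U = (4 *\<^sub>m mat 1) ** ((1 / 2) *\<^sub>m (Ypp + Ymp))"
    unfolding mscale_simps(1-3) by (simp add: P_def U_def mscale_def map_matrix_def vec_eq_iff)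
  moreover have "invertible (4 *\<^sub>m mat 1)"
    unfolding invertible_def by (rule exI[of _ "(1 / 4) *\<^sub>m mat 1"]) (simp add: mscale_simps)
  ultimately have inv_PU: "invertible (P + U)"
    using inv_a by (simp only: invertible_mult)

  have ba: "(1/16 * dy^2 * dv^2) *\<^sub>m (Dx L B x u ** Du K A x u) = \<beta>' ** \<alpha>'"
    and ab: "(1/16 * dy^2 * dv^2) *\<^sub>m (Du K A x u ** Dx L B x u) = \<alpha>' ** \<beta>'"
    by (simp_all add: \<alpha>'_def \<beta>'_def mscale_simps power2_eq_square ac_simps)
  show ?thesis
    unfolding ba ab
  proof (intro conjI impI; elim conjE)
    assume inv: "invertible (mat 1 - \<beta>' ** \<alpha>')" "invertible (mat 1 - \<alpha>' ** \<beta>')"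
    show "Du K A x u - Dx L B x u + Mu K A x u ** Mx L B x u - Mx L B x u ** Mu K A x u
        = (1/4 * dv^2) *\<^sub>m
            (Mx L B x u ** Du K A x u ** matrix_inv (mat 1 - \<beta>' ** \<alpha>')
             ** (Mx L B x u + (1/4 * dy^2) *\<^sub>m (Dx L B x u ** Mu K A x u)))
          - (1/4 * dy^2) *\<^sub>m
            (Mu K A x u ** Dx L B x u ** matrix_inv (mat 1 - \<alpha>' ** \<beta>')
             ** (Mu K A x u + (1/4 * dv^2) *\<^sub>m (Du K A x u ** Mx L B x u)))"
    \<comment> \<open>Every term of the abstract equation carries the factor
      \<open>dy * dv / 4\<close>.\<close>
    proof (rule mscale_cancel)
      show "dy * dv / 4 \<noteq> 0"
        using y(4) v(4) by simp
      have "(dy * dv / 4) *\<^sub>m (Du K A x u - Dx L B x u + Mu K A x u ** Mx L B x u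
          - Mx L B x u ** Mu K A x u) = \<alpha>' - \<beta>' + \<alpha> ** \<beta> - \<beta> ** \<alpha>"
        by (simp add: \<alpha>_def \<alpha>'_def \<beta>_def \<beta>'_def mscale_simps ac_simps)
      also have "\<dots> = \<beta> ** \<alpha>' ** matrix_inv (mat 1 - \<beta>' ** \<alpha>') ** (\<beta> + \<beta>' ** \<alpha>)
          - \<alpha> ** \<beta>' ** matrix_inv (mat 1 - \<alpha>' ** \<beta>') ** (\<alpha> + \<alpha>' ** \<beta>)"
        by (rule schlesinger_of_edge_relations[OF X_eq Z_eq U_eq Z_eq' inv_PU inv])
      also have "\<dots> = (dy * dv / 4) *\<^sub>m ((1/4 * dv^2) *\<^sub>m
            (Mx L B x u ** Du K A x u ** matrix_inv (mat 1 - \<beta>' ** \<alpha>')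
             ** (Mx L B x u + (1/4 * dy^2) *\<^sub>m (Dx L B x u ** Mu K A x u)))
          - (1/4 * dy^2) *\<^sub>m
            (Mu K A x u ** Dx L B x u ** matrix_inv (mat 1 - \<alpha>' ** \<beta>')
             ** (Mu K A x u + (1/4 * dv^2) *\<^sub>m (Du K A x u ** Mx L B x u))))"
        (is "?Q (matrix_inv _) (matrix_inv _) = ?T (matrix_inv _) (matrix_inv _)")
      proof -
        \<comment> \<open>Only scalar factors are compared, so arbitrary \<open>I\<close>,
          \<open>J\<close> replace the inverses and the scalars inside those stay untouched.\<close>
        have "?Q I J = ?T I J" for I J
          by (simp add: \<alpha>_def \<alpha>'_def \<beta>_def \<beta>'_def mscale_simps matrix_distribs
              power2_eq_square ac_simps)
        then show ?thesis .
      qed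
      finally show "(dy * dv / 4) *\<^sub>m (Du K A x u - Dx L B x u + Mu K A x u ** Mx L B x u
          - Mx L B x u ** Mu K A x u) = \<dots>" .
    qed
  next
    assume "invertible (mat 1 - (dy/2) *\<^sub>m A x vp)" "invertible (mat 1 - (dv/2) *\<^sub>m B ym u)"
      "invertible (mat 1 - (dv/2) *\<^sub>m B yp u)" "invertible (mat 1 - (dy/2) *\<^sub>m A x vm)"
    then show "matrix_inv (mat 1 - (dy/2) *\<^sub>m A x vp) ** (mat 1 + (dy/2) *\<^sub>m A x vp)
        ** matrix_inv (mat 1 - (dv/2) *\<^sub>m B ym u) ** (mat 1 + (dv/2) *\<^sub>m B ym u)
        = matrix_inv (mat 1 - (dv/2) *\<^sub>m B yp u) ** (mat 1 + (dv/2) *\<^sub>m B yp u)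
          ** matrix_inv (mat 1 - (dy/2) *\<^sub>m A x vm) ** (mat 1 + (dy/2) *\<^sub>m A x vm)"
      using product_form unfolding a_def b_def c_def d_def by simp
  qed
qed

end
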